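(* Let $m>n\ge 2$ be integers. Then $|A_n\cap A_m|\leq \tau_{m,n}$. Furthermore, if $m$ is even and $n$ is odd, then equality holds, i.e. $|A_n\cap A_m|=\tau_{m,n}$.
   Context: For an integer $k\geq 2$, let $A_k=\{r(k-r): r\in\mathbb{Z},\ 1\leq r\leq k-1\}$ (a set of integers, so repeated values are counted once). For integers $m>n\ge 2$, let $T_{m,n}$ be the set of pairs of integers $(M,N)$ such that $NM=m^2-n^2$, $M+N<2m$, and $0<M\leq N<M+2n$. Write $\tau_{m,n}:=|T_{m,n}|$. Here $|X|$ denotes the cardinality of a finite set $X$. *)

theory Defs
  imports Main
begin

definition A :: "int \<Rightarrow> int set" where
  "A k = {r * (k - r) | r. 1 \<le> r \<and> r \<le> k - 1}"

definition T :: "int \<Rightarrow> int \<Rightarrow> (int \<times> int) set" where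
  "T m n = {(M, N). N * M = m\<^sup>2 - n\<^sup>2 \<and> M + N < 2 * m \<and> 0 < M \<and> M \<le> N \<and> N < M + 2 * n}"

definition \<tau> :: "int \<Rightarrow> int \<Rightarrow> nat" where
  "\<tau> m n = card (T m n)"

text \<open>Both sets are finite, so \<^const>\<open>card\<close> never takes its default value 0 for infinite sets.\<close>

lemma finite_A: "finite (A k)"
proof -
  have "A k = (\<lambda>r. r * (k - r)) ` {1..k - 1}"
    by (auto simp: A_def)
  then show ?thesis by simp
qed

lemma finite_T: "finite (T m n)"
proof (rule finite_subset)
  show "T m n \<subseteq> {0..2 * m} \<times> {0..2 * m}"
    by (auto simp: T_def)
qed simp

end

theory Submission
  imports Defs
begin

text \<open>A common value \<open>r * (n - r) = s * (m - s)\<close>, with \<open>r\<close> and \<open>s\<close> in the lower halves of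
  their ranges, gives \<open>a = n - 2 * r \<ge> 0\<close> and \<open>b = m - 2 * s \<ge> 0\<close> with
  \<open>b\<^sup>2 - a\<^sup>2 = m\<^sup>2 - n\<^sup>2\<close>. The factorization \<open>(M, N) = (b - a, b + a)\<close> then lies in \<open>T m n\<close>
  and determines the value. Conversely, a pair in \<open>T m n\<close> arises this way iff \<open>a = (N - M) / 2\<close>
  and \<open>b = (N + M) / 2\<close> are integers with the parities of \<open>n\<close> and \<open>m\<close>; for \<open>m\<close> even and \<open>n\<close>
  odd this is automatic, because \<open>b\<^sup>2 - a\<^sup>2\<close> is then 3 modulo 4.\<close>

text \<open>Since \<open>r\<close> and \<open>k - r\<close> give the same value, keeping only lower
  halves leaves one pair \<open>(r, s)\<close> per common value.\<close>

definition coincidences :: "int \<Rightarrow> int \<Rightarrow> (int \<times> int) set" where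
  "coincidences m n =
    {(r, s). r * (n - r) = s * (m - s) \<and> 1 \<le> r \<and> 2 * r \<le> n \<and> 1 \<le> s \<and> 2 * s \<le> m}"

definition factor_pair :: "int \<Rightarrow> int \<Rightarrow> int \<times> int \<Rightarrow> int \<times> int" where
  "factor_pair m n = (\<lambda>(r, s). ((m - 2 * s) - (n - 2 * r), (m - 2 * s) + (n - 2 * r)))"

lemma mem_A_iff: "v \<in> A k \<longleftrightarrow> (\<exists>r. v = r * (k - r) \<and> 1 \<le> r \<and> 2 * r \<le> k)"
proof
  assume "v \<in> A k"
  then obtain r where r: "v = r * (k - r)" "1 \<le> r" "r \<le> k - 1"
    by (auto simp: A_def)
  show "\<exists>r. v = r * (k - r) \<and> 1 \<le> r \<and> 2 * r \<le> k"
  proof (cases "2 * r \<le> k")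
    case False
    with r show ?thesis by (intro exI[of _ "k - r"]) auto
  qed (use r in blast)
qed (auto simp: A_def)

text \<open>The only other solution is \<open>s = k - r\<close>, and two elements of the lower half
  add up to \<open>k\<close> only if both are \<open>k / 2\<close>.\<close>

lemma lower_half_unique:
  fixes r s k :: int
  assumes "r * (k - r) = s * (k - s)" "2 * r \<le> k" "2 * s \<le> k"
  shows "r = s"
proof -
  have "(r - s) * (k - r - s) = 0"
    using assms(1) by (simp add: algebra_simps)
  with assms(2,3) show ?thesis by auto
qed

lemma card_coincidences: "card (A n \<inter> A m) = card (coincidences m n)"
proof -
  have "inj_on (\<lambda>(r, s). r * (n - r)) (coincidences m n)"
    by (clarsimp simp: inj_on_def coincidences_def) (metis lower_half_unique)
  moreover have "(\<lambda>(r, s). r * (n - r)) ` coincidences m n = A n \<inter> A m"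
    by (force simp: mem_A_iff coincidences_def)
  ultimately show ?thesis
    by (metis card_image)
qed

lemma inj_factor_pair: "inj (factor_pair m n)"
  by (auto simp: inj_def factor_pair_def)

text \<open>Completing the square: \<open>4 * r * (n - r)\<close> is
  \<open>n\<^sup>2 - (n - 2 * r)\<^sup>2\<close>, and likewise for \<open>s\<close> and
  \<open>m\<close>.\<close>

lemma coincidence_iff:
  fixes m n r s :: int
  shows "r * (n - r) = s * (m - s) \<longleftrightarrow> (m - 2 * s)\<^sup>2 - (n - 2 * r)\<^sup>2 = m\<^sup>2 - n\<^sup>2"
proof -
  have "(m - 2 * s)\<^sup>2 - (n - 2 * r)\<^sup>2 - (m\<^sup>2 - n\<^sup>2) = 4 * (r * (n - r) - s * (m - s))"
    by (simp add: algebra_simps power2_eq_square)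
  then show ?thesis by auto
qed

lemma factor_pair_in_T:
  assumes "0 < n" "n < m" "p \<in> coincidences m n"
  shows "factor_pair m n p \<in> T m n"
proof -
  obtain r s where p: "p = (r, s)" by fastforce
  define a b where "a = n - 2 * r" and "b = m - 2 * s"
  have ab: "0 \<le> a" "a < n" "0 \<le> b" "b < m" and sq: "b\<^sup>2 - a\<^sup>2 = m\<^sup>2 - n\<^sup>2"
    using assms(3) by (auto simp: p coincidences_def coincidence_iff a_def b_def)
  \<comment> \<open>This makes the smaller factor \<open>b - a\<close> positive. The other bounds in
    \<open>T\<close> are those on \<open>a\<close> and \<open>b\<close>: the factors have sum
    \<open>2 * b\<close> and difference \<open>2 * a\<close>.\<close>
  have "n\<^sup>2 < m\<^sup>2"
    using assms by (intro power_strict_mono) auto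
  with sq have "a < b"
    using ab by (intro power2_less_imp_less[of a b]) auto
  moreover have "(b + a) * (b - a) = m\<^sup>2 - n\<^sup>2"
    using sq by (simp add: algebra_simps power2_eq_square)
  moreover have "factor_pair m n p = (b - a, b + a)"
    by (simp add: factor_pair_def p a_def b_def)
  ultimately show ?thesis
    using ab by (simp add: T_def)
qed

text \<open>Squares are 0 or 1 modulo 4, so a difference congruent to -1 can only be 0 - 1.\<close>

lemma square_diff_parity:
  fixes a b m n :: int
  assumes "b\<^sup>2 - a\<^sup>2 = m\<^sup>2 - n\<^sup>2" "even m" "odd n"
  shows "even b" and "odd a"
proof -
  have mod4: "x\<^sup>2 mod 4 = (if even x then 0 else 1)" for x :: int
  proof (cases "even x")
    case True
    then show ?thesis by (auto elim!: evenE simp: power2_eq_square)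
  next
    case False
    then obtain y where "x = 2 * y + 1" by (auto elim: oddE)
    then have "x\<^sup>2 = 1 + (y\<^sup>2 + y) * 4"
      by (simp add: algebra_simps power2_eq_square)
    then have "x\<^sup>2 mod 4 = 1 mod 4"
      by (simp only: mod_mult_self1)
    with False show ?thesis by simp
  qed
  have "(b\<^sup>2 mod 4 - a\<^sup>2 mod 4) mod 4 = (m\<^sup>2 mod 4 - n\<^sup>2 mod 4) mod 4"
    using assms(1) by (simp add: mod_diff_eq)
  then show "even b" "odd a"
    using assms(2,3) by (auto simp: mod4 split: if_splits)
qed

lemma T_subset_factor_pair:
  assumes "even m" "odd n"
  shows "T m n \<subseteq> factor_pair m n ` coincidences m n"
proof
  fix q assume "q \<in> T m n"
  then obtain M N where q: "q = (M, N)" "N * M = m\<^sup>2 - n\<^sup>2" "M + N < 2 * m" "0 < M" "M \<le> N"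
    "N < M + 2 * n"
    by (auto simp: T_def)
  \<comment> \<open>Both factors must be odd, so their half-sum \<open>b\<close> is an
    integer.\<close>
  have "odd (N * M)"
    using q(2) assms by simp
  then have "odd N" "odd M" by auto
  then obtain b where b: "N + M = 2 * b" by (metis evenE odd_even_add)
  define a where "a = N - b"
  have MN: "N = b + a" "M = b - a" using b by (auto simp: a_def)
  have sq: "b\<^sup>2 - a\<^sup>2 = m\<^sup>2 - n\<^sup>2"
    using q(2) by (simp add: MN algebra_simps power2_eq_square)
  then have "even b" "odd a"
    using assms square_diff_parity by blast+
  with assms have "even (m - b)" "even (n - a)" by auto
  then obtain r s where "n - a = 2 * r" "m - b = 2 * s" by (meson evenE)
  then have rs: "a = n - 2 * r" "b = m - 2 * s" by auto
  have "(r, s) \<in> coincidences m n"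
    using q sq by (auto simp: coincidences_def coincidence_iff MN rs)
  moreover have "q = factor_pair m n (r, s)"
    by (simp add: factor_pair_def q MN rs)
  ultimately show "q \<in> factor_pair m n ` coincidences m n" by blast
qed

theorem theorem1p1:
  fixes m n :: int
  assumes "m > n" and "n \<ge> 2"
  shows "card (A n \<inter> A m) \<le> \<tau> m n \<and> (even m \<and> odd n \<longrightarrow> card (A n \<inter> A m) = \<tau> m n)"
proof -
  \<comment> \<open>By injectivity, both claims reduce to inclusions between this image and
    \<open>T m n\<close>.\<close>
  have card: "card (A n \<inter> A m) = card (factor_pair m n ` coincidences m n)"
    by (metis card_coincidences card_image inj_factor_pair inj_on_subset subset_UNIV)
  have sub: "factor_pair m n ` coincidences m n \<subseteq> T m n"
    using assms by (intro image_subsetI factor_pair_in_T) auto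
  show ?thesis
    unfolding card \<tau>_def
    using card_mono[OF finite_T sub] sub T_subset_factor_pair[of m n] by (metis subset_antisym)
qed

end
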